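(* Let $P_{-3,k}(c)$ $(k\geq -4)$ be the polynomials in $c$ satisfying $$(6+2k)P_{-3,k}(c)=4kc\,P_{-3,k-2}(c)-2(k-3)P_{-3,k-4}(c)\qquad(k\geq 0)$$ with initial conditions $P_{-3,-3}=1$ and $P_{-3,-4}=P_{-3,-2}=P_{-3,-1}=0$. Then the generating function $P_{-3}(c,z)=\sum_{n\geq 0}P_{-3,n-4}(c)z^n$ is $$ P_{-3}(c,z)=\frac{1}{c^2-1}\left(c^2z-cz^3-z\sqrt{z^4-2cz^2+1}\right). $$ Hence $P_{-3,2m}(c)=0$ for $m\geq 0$, and $$ P_{-3,2n-3}(c)=\frac{-Q_n^{(-1/2)}(c)}{c^2-1}\qquad\text{for } n\geq 2, $$ and for $n\geq 2$ the polynomial $P_{-3,2n-3}=P_{-3,2n-3}(c)$ satisfies $$ (c^2-1)\frac{d^2}{dc^2}P_{-3,2n-3}+4c\frac{d}{dc}P_{-3,2n-3}-(n+1)(n-2)P_{-3,2n-3}=0. $$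
   Context: $Q_n^{(-1/2)}(c)$ is the $n$-th Gegenbauer (ultraspherical) polynomial with parameter $-1/2$, defined by $\sqrt{1-2cz^2+z^4}=\sum_{n\ge0}Q_n^{(-1/2)}(c)z^{2n}$, where the square root is the formal power series in $z$ with constant term $1$. Identities with denominator $c^2-1$ are identities of rational functions of $c$ (equivalently, for $c\neq\pm1$). *)

theory Defs
  imports "HOL-Computational_Algebra.Computational_Algebra"
begin

abbreviation indet :: "'a::comm_semiring_1 poly"
  where "indet \<equiv> [:0, 1:]"

abbreviation indet_frac :: "'a::field poly fract"
  where "indet_frac \<equiv> to_fract indet"

text \<open>
  The formal square root with constant term 1. Unlike the library's \<open>fps_radical\<close>, it makes
  sense over coefficient rings that are not fields, such as polynomial rings.
\<close>

definition fps_sqrt1 :: "'b::comm_ring_1 fps \<Rightarrow> 'b fps"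
  where "fps_sqrt1 f = (THE g. fps_nth g 0 = 1 \<and> g ^ 2 = f)"

definition gegenbauer_minus_half :: "nat \<Rightarrow> 'a::field_char_0 poly"
  where "gegenbauer_minus_half n =
    fps_nth (fps_sqrt1 (1 - fps_const (2 * indet) * fps_X ^ 2 + fps_X ^ 4)) (2 * n)"

text \<open>The description operator above is well-defined wherever 2 is invertible.\<close>

fun sqrt1_coeff :: "'b::comm_ring_1 \<Rightarrow> (nat \<Rightarrow> 'b) \<Rightarrow> nat \<Rightarrow> 'b" where
  "sqrt1_coeff h f n = (if n = 0 then 1 else
     h * (f n - (\<Sum>i\<in>{1..<n}. if i < n \<and> 0 < i then
        sqrt1_coeff h f i * sqrt1_coeff h f (n - i) else 0)))"

declare sqrt1_coeff.simps [simp del]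

lemma ex1_fps_sqrt1:
  fixes f :: "'b::idom fps" and h :: 'b
  assumes h: "2 * h = 1" and f0: "fps_nth f 0 = 1"
  shows "\<exists>!g. fps_nth g 0 = 1 \<and> g ^ 2 = f"
proof (rule ex_ex1I)
  define a where "a = sqrt1_coeff h (fps_nth f)"
  have a0: "a 0 = 1"
    by (simp add: a_def sqrt1_coeff.simps)
  have "(\<Sum>i=0..n. a i * a (n - i)) = fps_nth f n" for n
  proof (cases "n = 0")
    case True
    then show ?thesis by (simp add: a0 f0)
  next
    case False
    define s where "s = (\<Sum>i\<in>{1..<n}. a i * a (n - i))"
    have "s = (\<Sum>i\<in>{1..<n}. if i < n \<and> 0 < i then a i * a (n - i) else 0)"
      unfolding s_def by (rule sum.cong) auto
    then have an: "a n = h * (fps_nth f n - s)"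
      using False unfolding a_def by (subst sqrt1_coeff.simps) simp
    have "{0..n} = insert 0 (insert n {1..<n})"
      using False by auto
    then have "(\<Sum>i=0..n. a i * a (n - i)) = 2 * a n + s"
      using False by (simp add: s_def a0)
    also have "\<dots> = (2 * h) * (fps_nth f n - s) + s"
      by (simp add: an mult.assoc)
    finally show ?thesis by (simp add: h)
  qed
  then have "Abs_fps a ^ 2 = f"
    by (simp add: power2_eq_square fps_eq_iff fps_mult_nth)
  then show "\<exists>g. fps_nth g 0 = 1 \<and> g ^ 2 = f"
    by (intro exI [of _ "Abs_fps a"]) (simp add: a0)
next
  fix g g' :: "'b fps"
  assume g: "fps_nth g 0 = 1 \<and> g ^ 2 = f" and g': "fps_nth g' 0 = 1 \<and> g' ^ 2 = f"
  then have "g = g' \<or> g = - g'"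
    by (metis power2_eq_iff)
  moreover have "g \<noteq> - g'"
  proof
    assume "g = - g'"
    then have "(1::'b) = - 1"
      using g g' by (metis fps_neg_nth)
    then have "(2::'b) = 0"
      by (metis add.right_inverse one_add_one)
    with h show False by simp
  qed
  ultimately show "g = g'" by blast
qed

lemma fps_sqrt1:
  fixes f :: "'b::idom fps" and h :: 'b
  assumes "2 * h = 1" and "fps_nth f 0 = 1"
  shows "fps_nth (fps_sqrt1 f) 0 = 1" and "fps_sqrt1 f ^ 2 = f"
  using theI' [OF ex1_fps_sqrt1 [OF assms]] unfolding fps_sqrt1_def by auto

end

theory Submission
  imports Defs
begin

text \<open>
  Write \<open>S\<close> for the square root of \<open>F = 1 - 2cz\<^sup>2 + z\<^sup>4\<close>. Differentiating \<open>S\<^sup>2 = F\<close> in \<open>z\<close> gives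
  \<open>2 F S' = F' S\<close>, and comparing coefficients shows that the coefficient of \<open>z\<^sup>m\<close> in \<open>S\<close> satisfies the
  recursion of \<open>P (m - 3)\<close>. The two sequences are therefore proportional from \<open>m = 3\<close> on, with
  factor \<open>1 - c\<^sup>2\<close>: the recursion stops seeing the initial values at \<open>m = 6\<close>, where the coefficient
  \<open>k - 3\<close> vanishes. Differentiating \<open>S\<^sup>2 = F\<close> twice both in \<open>c\<close> and in \<open>z\<close> yields
  \<open>4 (1 - c\<^sup>2) S\<^sub>c\<^sub>c + z\<^sup>2 S\<^sub>z\<^sub>z - z S\<^sub>z = 0\<close>, whose coefficients are the differential equations.
\<close>

section \<open>Differentiation in the coefficient variable \<open>c\<close>\<close>

definition fps_pderiv :: "'a::idom poly fps \<Rightarrow> 'a poly fps"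
  where "fps_pderiv f = Abs_fps (\<lambda>n. pderiv (fps_nth f n))"

lemma fps_pderiv_nth [simp]: "fps_nth (fps_pderiv f) n = pderiv (fps_nth f n)"
  by (simp add: fps_pderiv_def)

lemma fps_pderiv_mult: "fps_pderiv (f * g) = f * fps_pderiv g + fps_pderiv f * g"
proof (rule fps_ext)
  fix n
  have "fps_nth (fps_pderiv (f * g)) n =
      (\<Sum>i=0..n. pderiv (fps_nth f i * fps_nth g (n - i)))"
    by (simp add: fps_mult_nth higher_pderiv_sum[where n=1, simplified])
  also have "\<dots> = fps_nth (f * fps_pderiv g + fps_pderiv f * g) n"
    by (simp add: fps_mult_nth pderiv_mult sum.distrib mult.commute [of "pderiv _"])
  finally show "fps_nth (fps_pderiv (f * g)) n = fps_nth (f * fps_pderiv g + fps_pderiv f * g) n" .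
qed

section \<open>The square root over polynomials and over rational functions\<close>

abbreviation gegenbauer_quartic :: "'b::comm_ring_1 \<Rightarrow> 'b fps"
  where "gegenbauer_quartic c \<equiv> 1 - fps_const (2 * c) * fps_X ^ 2 + fps_X ^ 4"

lemma fps_nth_gegenbauer_quartic:
  "fps_nth (gegenbauer_quartic c) n =
    (if n = 0 then 1 else if n = 2 then - 2 * c else if n = 4 then 1 else 0)"
  by (auto simp: fps_X_power_iff)

lemma fps_const_double: "fps_const (2 * c) = 2 * fps_const (c :: 'b::comm_ring_1)"
  by (simp add: fps_numeral_fps_const)

text \<open>Provides the witness \<open>h\<close> for the invertibility of 2 that
  \<open>fps_sqrt1\<close> asks for; \<open>half_fract\<close> does the same over the fraction
  field.\<close>

lemma half_poly: "2 * [:1 / 2:] = (1 :: 'a::field_char_0 poly)"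
  by (simp add: numeral_poly one_pCons)

lemma half_fract: "2 * to_fract [:1 / 2:] = (1 :: 'a::field_char_0 poly fract)"
  by (metis half_poly mult_2 to_fract_1 to_fract_add)

abbreviation gegenbauer_gf :: "'a::field_char_0 poly fps"
  where "gegenbauer_gf \<equiv> fps_sqrt1 (gegenbauer_quartic indet)"

lemma gegenbauer_gf_0: "fps_nth (gegenbauer_gf :: 'a::field_char_0 poly fps) 0 = 1"
  and gegenbauer_gf_square:
    "(gegenbauer_gf :: 'a::field_char_0 poly fps) ^ 2 = gegenbauer_quartic indet"
  using fps_sqrt1 [OF half_poly, of "gegenbauer_quartic indet :: 'a poly fps"]
  by (simp_all add: fps_nth_gegenbauer_quartic)

lemma to_fract_numeral: "to_fract (numeral k) = numeral k"
  by (induction k) (simp_all only: numeral.simps to_fract_1 to_fract_add)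

text \<open>The generating function takes its root over the fraction field,
  \<open>gegenbauer_minus_half\<close> over the polynomial ring. As \<open>to_fract\<close> is a
  ring homomorphism, the image of the polynomial root again squares to the quartic with constant
  term 1, and such a root is unique.\<close>

lemma fps_sqrt1_quartic_fract:
  "fps_sqrt1 (gegenbauer_quartic indet_frac) =
    Abs_fps (\<lambda>n. to_fract (fps_nth (gegenbauer_gf :: 'a::field_char_0 poly fps) n))"
    (is "fps_sqrt1 ?F = ?T")
proof -
  have "?T ^ 2 = ?F"
  proof (rule fps_ext)
    fix n
    have "fps_nth (?T ^ 2) n = to_fract (fps_nth ((gegenbauer_gf :: 'a poly fps) ^ 2) n)"
      by (simp add: power2_eq_square fps_mult_nth)
    also have "\<dots> = fps_nth ?F n"
      unfolding gegenbauer_gf_square fps_nth_gegenbauer_quartic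
      by (simp only: to_fract_mult to_fract_uminus to_fract_numeral split: if_split) simp
    finally show "fps_nth (?T ^ 2) n = fps_nth ?F n" .
  qed
  moreover have "fps_nth ?T 0 = 1"
    by (simp only: fps_nth_Abs_fps gegenbauer_gf_0 to_fract_1)
  moreover have "\<exists>!g. fps_nth g 0 = 1 \<and> g ^ 2 = ?F"
    by (rule ex1_fps_sqrt1 [OF half_fract]) (simp add: fps_nth_gegenbauer_quartic)
  ultimately show ?thesis
    unfolding fps_sqrt1_def by (intro the1_equality) auto
qed

section \<open>Derivatives in \<open>z\<close> and the recursion for the coefficients of the
  root\<close>

context
  fixes S :: "'b::{idom, ring_char_0} fps" and c :: 'b
  assumes square: "S ^ 2 = gegenbauer_quartic c"
begin

lemma quartic_sqrt_square: "S * S = 1 - 2 * fps_const c * fps_X ^ 2 + fps_X ^ 4"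
  using square by (simp add: power2_eq_square fps_const_double)

lemma quartic_sqrt_deriv: "S * fps_deriv S = 2 * fps_X ^ 3 - 2 * fps_const c * fps_X"
proof -
  have "fps_deriv (S * S) = fps_deriv (1 - 2 * fps_const c * fps_X ^ 2 + fps_X ^ 4)"
    by (simp only: quartic_sqrt_square)
  then have "2 * (S * fps_deriv S) = 2 * (2 * fps_X ^ 3 - 2 * fps_const c * fps_X)"
    by (simp add: fps_deriv_power algebra_simps flip: fps_numeral_fps_const)
  then show ?thesis by (simp only: mult_cancel_left) simp
qed

lemma quartic_sqrt_deriv2:
  "S * fps_deriv (fps_deriv S) = 6 * fps_X ^ 2 - 2 * fps_const c - fps_deriv S ^ 2"
proof -
  have "fps_deriv (S * fps_deriv S) = fps_deriv (2 * fps_X ^ 3 - 2 * fps_const c * fps_X)"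
    by (simp only: quartic_sqrt_deriv)
  then show ?thesis
    by (simp add: fps_deriv_power algebra_simps power2_eq_square flip: fps_numeral_fps_const)
qed

text \<open>Evaluate \<open>S * S * fps_deriv S\<close> in two ways, through \<open>S * S\<close>
  and through \<open>S * fps_deriv S\<close>. Negative terms are moved across and constants
  bracketed outermost, so that coefficients can be read off term by term.\<close>

lemma quartic_sqrt_ode:
  "fps_deriv S + fps_X ^ 4 * fps_deriv S + 2 * (fps_const c * (fps_X * S)) =
    2 * (fps_const c * (fps_X ^ 2 * fps_deriv S)) + 2 * (fps_X ^ 3 * S)"
  using quartic_sqrt_square quartic_sqrt_deriv by algebra

lemma quartic_sqrt_ode_nth:
  "fps_nth (fps_deriv S) n + fps_nth (fps_X ^ 4 * fps_deriv S) n + 2 * (c * fps_nth (fps_X * S) n) =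
    2 * (c * fps_nth (fps_X ^ 2 * fps_deriv S) n) + 2 * fps_nth (fps_X ^ 3 * S) n"
  using arg_cong [OF quartic_sqrt_ode, of "\<lambda>f. fps_nth f n"]
  by (simp only: fps_add_nth fps_numeral_fps_const fps_mult_left_const_nth)

lemma quartic_sqrt_nth_1: "fps_nth S 1 = 0"
  using quartic_sqrt_ode_nth [of 0] by (simp add: fps_X_power_mult_nth)

lemma quartic_sqrt_nth_2: "fps_nth S 2 = - c * fps_nth S 0"
proof -
  have "2 * (fps_nth S 2 + c * fps_nth S 0) = 0"
    using quartic_sqrt_ode_nth [of 1]
    by (simp add: fps_X_power_mult_nth algebra_simps numeral_2_eq_2)
  then show ?thesis by (simp add: add_eq_0_iff2)
qed

lemma quartic_sqrt_nth_3: "fps_nth S 3 = 0"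
  using quartic_sqrt_ode_nth [of 2] quartic_sqrt_nth_1
  by (simp add: fps_X_power_mult_nth)

text \<open>This is degree \<open>n + 3\<close> of the differential equation. The case
  \<open>n = 0\<close> is separate because \<open>fps_X ^ 4 * fps_deriv S\<close> then contributes
  nothing, while the index \<open>n - 1\<close> is truncated.\<close>

lemma quartic_sqrt_rec:
  "of_nat (n + 4) * fps_nth S (n + 4) =
    of_nat (2 * n + 2) * c * fps_nth S (n + 2) + (2 - of_nat n) * fps_nth S n"
proof -
  have "n + 3 - 4 = n - 1" "(n + 3 < 4) = (n = 0)" by auto
  then show ?thesis
    using quartic_sqrt_ode_nth [of "n + 3"]
    by (cases "n = 0")
      (simp_all only: fps_X_power_mult_nth, simp_all add: algebra_simps numeral_2_eq_2)
qed

end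

section \<open>Derivatives in \<open>c\<close> and the differential equation for the
  coefficients\<close>

context
  fixes S :: "'a::field_char_0 poly fps" and c :: "'a poly"
  assumes square: "S ^ 2 = gegenbauer_quartic c" and deriv_c: "pderiv c = 1"
begin

lemma quartic_sqrt_pderiv: "S * fps_pderiv S = - (fps_X ^ 2)"
proof -
  have "fps_pderiv (S * S) = fps_pderiv (gegenbauer_quartic c)"
    by (simp only: square flip: power2_eq_square)
  also have "\<dots> = - 2 * fps_X ^ 2"
  proof (rule fps_ext)
    fix n
    have "pderiv (- 2 * c) = - 2"
      by (simp add: pderiv_mult pderiv_minus deriv_c)
    moreover have "fps_nth (- 2 * fps_X ^ 2 :: 'a poly fps) n = (if n = 2 then - 2 else 0)"
      by (simp add: neg_numeral_fps_const fps_X_power_iff del: fps_const_neg)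
    ultimately show "fps_nth (fps_pderiv (gegenbauer_quartic c)) n =
        fps_nth (- 2 * fps_X ^ 2) n"
      by (simp only: fps_pderiv_nth fps_nth_gegenbauer_quartic) simp
  qed
  finally have "2 * (S * fps_pderiv S) = 2 * (- (fps_X ^ 2))"
    by (simp add: fps_pderiv_mult algebra_simps)
  then show ?thesis by (simp only: mult_cancel_left) simp
qed

text \<open>The right side of \<open>quartic_sqrt_pderiv\<close> is free of \<open>c\<close>, so
  differentiating it once more gives 0.\<close>

lemma quartic_sqrt_pderiv2: "S * fps_pderiv (fps_pderiv S) = - (fps_pderiv S ^ 2)"
proof -
  have "fps_pderiv (S * fps_pderiv S) = 0"
    unfolding quartic_sqrt_pderiv by (rule fps_ext) (simp add: fps_X_power_iff pderiv_minus)
  then show ?thesis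
    by (simp add: fps_pderiv_mult power2_eq_square eq_neg_iff_add_eq_0)
qed

lemma quartic_sqrt_pde:
  "4 * ((1 - fps_const c ^ 2) * fps_pderiv (fps_pderiv S)) + fps_X ^ 2 * fps_deriv (fps_deriv S)
    - fps_X * fps_deriv S = 0" (is "?E = 0")
proof -
  \<comment> \<open>A cube suffices: one factor \<open>S\<close> reduces a second derivative to the
    square of a first one, and two more turn that square into a polynomial in \<open>c\<close> and
    \<open>z\<close>.\<close>
  have "S ^ 3 * ?E = 0"
    using quartic_sqrt_square [OF square] quartic_sqrt_deriv [OF square] quartic_sqrt_deriv2 [OF square]
      quartic_sqrt_pderiv quartic_sqrt_pderiv2
    by algebra
  moreover have "S \<noteq> 0"
    using square fps_nth_gegenbauer_quartic [of c 0]
    by (metis fps_zero_nth power_zero_numeral zero_neq_one)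
  ultimately show ?thesis by simp
qed

lemma quartic_sqrt_nth_ode:
  "(1 - c ^ 2) * pderiv (pderiv (fps_nth S (2 * n)))
    + of_nat n * (of_nat n - 1) * fps_nth S (2 * n) = 0"
proof -
  have "1 - fps_const c ^ 2 = fps_const (1 - c ^ 2)"
    by (simp flip: fps_const_sub)
  then have "4 * ((1 - c ^ 2) * pderiv (pderiv (fps_nth S (2 * n))))
      + fps_nth (fps_X ^ 2 * fps_deriv (fps_deriv S)) (2 * n)
      - fps_nth (fps_X * fps_deriv S) (2 * n) = 0"
    using arg_cong [OF quartic_sqrt_pde, of "\<lambda>f. fps_nth f (2 * n)"]
    by (simp only: fps_add_nth fps_sub_nth fps_numeral_fps_const fps_mult_left_const_nth
        fps_pderiv_nth fps_zero_nth)
  \<comment> \<open>On the power 2n of \<open>z\<close> the operator multiplies by 2n(2n - 1) - 2n =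
    4n(n - 1).\<close>
  moreover have "fps_nth (fps_X ^ 2 * fps_deriv (fps_deriv S)) (2 * n)
      - fps_nth (fps_X * fps_deriv S) (2 * n)
      = 4 * (of_nat n * (of_nat n - 1) * fps_nth S (2 * n))"
    by (cases n) (simp_all only: fps_X_power_mult_nth, simp_all add: algebra_simps)
  ultimately have "4 * ((1 - c ^ 2) * pderiv (pderiv (fps_nth S (2 * n)))
      + of_nat n * (of_nat n - 1) * fps_nth S (2 * n)) = 0"
    by algebra
  then show ?thesis by (simp only: mult_eq_0_iff) simp
qed

end

section \<open>Comparison of the two recursions and the theorem\<close>

lemma nat_cases3: "n = 0 \<or> n = 1 \<or> n = 2 \<or> (\<exists>l. n = l + 3)" for n :: nat
  by presburger

text \<open>One induction step for two sequences with the same recursion. The alternative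
  \<open>v = 0\<close> covers the index at which the older terms are not proportional but drop
  out.\<close>

lemma proportional_rec:
  fixes d :: "'b::idom"
  assumes "N \<noteq> 0" and "N * s = u * s1 + v * s0" and "N * p = u * p1 + v * p0"
    and "s1 = d * p1" and "v = 0 \<or> s0 = d * p0"
  shows "s = d * p"
proof -
  have "N * s = N * (d * p)"
    using assms(2-5) by algebra
  with \<open>N \<noteq> 0\<close> show ?thesis by simp
qed

theorem mainTheorem3:
  fixes P :: "int \<Rightarrow> 'a::field_char_0 poly"
  assumes rec: "\<And>k. k \<ge> 0 \<Longrightarrow>
      of_int (6 + 2 * k) * P k =
        of_int (4 * k) * indet * P (k - 2) - of_int (2 * (k - 3)) * P (k - 4)"
    and init: "P (- 3) = 1" "P (- 4) = 0" "P (- 2) = 0" "P (- 1) = 0"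
  shows
    "Abs_fps (\<lambda>n. to_fract (P (int n - 4))) =
       fps_const (1 / (indet_frac ^ 2 - 1)) *
         (fps_const (indet_frac ^ 2) * fps_X - fps_const indet_frac * fps_X ^ 3
          - fps_X * fps_sqrt1 (fps_X ^ 4 - fps_const (2 * indet_frac) * fps_X ^ 2 + 1))
     \<and> (\<forall>m::nat. P (2 * int m) = 0)
     \<and> (\<forall>n::nat. n \<ge> 2 \<longrightarrow>
          to_fract (P (2 * int n - 3)) =
            - to_fract (gegenbauer_minus_half n) / (indet_frac ^ 2 - 1))
     \<and> (\<forall>n::nat. n \<ge> 2 \<longrightarrow>
          (indet ^ 2 - 1) * pderiv (pderiv (P (2 * int n - 3)))
          + 4 * indet * pderiv (P (2 * int n - 3))
          - of_int ((int n + 1) * (int n - 2)) * P (2 * int n - 3) = 0)"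
proof -
  define S :: "'a poly fps" where "S = gegenbauer_gf"
  define c :: "'a poly" where "c = indet"
  have S0: "fps_nth S 0 = 1" and square: "S ^ 2 = gegenbauer_quartic c"
    unfolding S_def c_def by (fact gegenbauer_gf_0, fact gegenbauer_gf_square)
  have deriv_c: "pderiv c = 1"
    by (simp add: c_def pderiv_pCons one_pCons)
  note rec = rec [folded c_def]
  note S1 = quartic_sqrt_nth_1 [OF square] and S2 = quartic_sqrt_nth_2 [OF square, unfolded S0]
    and S3 = quartic_sqrt_nth_3 [OF square] and S_rec = quartic_sqrt_rec [OF square]
  \<comment> \<open>The recursion at k = n + 1, halved, has the coefficients of
    \<open>quartic_sqrt_rec\<close>.\<close>
  have rec': "of_nat (n + 4) * P (int n + 1) =
      of_nat (2 * n + 2) * c * P (int n - 1) + (2 - of_nat n) * P (int n - 3)" for n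
  proof -
    have "2 * (of_nat (n + 4) * P (int n + 1)) = 2 * (of_nat (2 * n + 2) * c * P (int n - 1)
        + (2 - of_nat n) * P (int n - 3))"
      using rec [of "int n + 1"] by (simp add: algebra_simps)
    then show ?thesis by (simp only: mult_cancel_left) simp
  qed
  have P0: "P 0 = 0"
    using rec [of 0] init by simp
  have even: "P (2 * int m) = 0" for m
  proof (induction m rule: less_induct)
    case (less m)
    have "P (2 * int m - 2) = 0 \<and> P (2 * int m - 4) = 0"
    proof -
      consider "m = 0" | "m = 1" | l where "m = l + 2"
        by (metis One_nat_def add_2_eq_Suc' not0_implies_Suc)
      then show ?thesis
        by cases (use init less [of "m - 1"] less [of "m - 2"] in auto)
    qed
    then have "of_int (6 + 2 * (2 * int m)) * P (2 * int m) = 0"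
      using rec [of "2 * int m"] by simp
    moreover have "of_int (6 + 2 * (2 * int m)) \<noteq> (0 :: 'a poly)"
      by (subst of_int_eq_0_iff) auto
    ultimately show ?case by simp
  qed
  have proportional: "fps_nth S (m + 3) = (1 - c ^ 2) * P (int m)" for m
  proof (induction m rule: less_induct)
    case (less m)
    consider "m = 0" | "m = 1" | "m = 2" | l where "m = l + 3"
      using nat_cases3 [of m] by blast
    then show ?case
    proof cases
      case 1
      then show ?thesis
        using S3 P0 by simp
    next
      case 2
      \<comment> \<open>The factor \<open>1 - c ^ 2\<close> originates here: the same recursion step
        starts from P(-1) = 0, P(-3) = 1 on one side and from the coefficients -c, 1 of
        \<open>S\<close> on the other.\<close>
      have "4 * P 1 = 2"
        using rec' [of 0] init by simp
      then have "4 * ((1 - c ^ 2) * P 1) = 2 - 2 * c ^ 2"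
        by (simp only: mult.left_commute [of 4]) (simp add: algebra_simps)
      also have "\<dots> = 4 * fps_nth S 4"
        using S_rec [of 0] S0 S2 by (simp add: power2_eq_square flip: numeral_2_eq_2)
      finally show ?thesis using 2 by (simp only: mult_cancel_left) simp
    next
      case 3
      have "5 * fps_nth S 5 = 0"
        using S_rec [of 1] S1 S3 by (simp flip: numeral_3_eq_3)
      then show ?thesis using even [of 1] 3 by simp
    next
      case 4
      define n where "n = l + 2"
      have "fps_nth S (n + 2) = (1 - c ^ 2) * P (int n - 1)"
        using less [of "l + 1"] 4 by (simp add: n_def eval_nat_numeral add.commute)
      \<comment> \<open>For \<open>l = 0\<close> we have n = 2 and the factor vanishes; otherwise
        \<open>l - 1\<close> is an earlier index of the induction.\<close>
      moreover have "2 - of_nat n = (0 :: 'a poly) \<or> fps_nth S n = (1 - c ^ 2) * P (int n - 3)"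
        using less [of "l - 1"] 4 by (cases l) (simp_all add: n_def eval_nat_numeral)
      moreover have "of_nat (n + 4) \<noteq> (0 :: 'a poly)"
        by (subst of_nat_eq_0_iff) simp
      ultimately have "fps_nth S (n + 4) = (1 - c ^ 2) * P (int n + 1)"
        using proportional_rec [OF _ S_rec [of n] rec' [of n]] by blast
      then show ?thesis using 4 by (simp add: n_def algebra_simps)
    qed
  qed
  have geg: "gegenbauer_minus_half n = fps_nth S (2 * n)" for n
    by (simp only: gegenbauer_minus_half_def S_def)
  have q: "gegenbauer_minus_half n = (1 - c ^ 2) * P (2 * int n - 3)" if "n \<ge> 2" for n
    using proportional [of "2 * n - 3"] that
    by (simp add: geg)
  have c2: "c ^ 2 - 1 \<noteq> 0"
    by (simp add: c_def power2_eq_square one_pCons)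
  define C where "C = to_fract c"
  have C2: "C ^ 2 - 1 = to_fract (c ^ 2 - 1)"
    by (simp add: C_def power2_eq_square)
  have nz: "C ^ 2 - 1 \<noteq> 0"
    unfolding C2 to_fract_eq_0_iff by (rule c2)
  have sqrt_C: "fps_sqrt1 (gegenbauer_quartic C) = Abs_fps (\<lambda>n. to_fract (fps_nth S n))"
    unfolding C_def c_def S_def by (rule fps_sqrt1_quartic_fract)
  have gf: "(C ^ 2 - 1) * to_fract (P (int n - 4)) =
      fps_nth (fps_const (C ^ 2) * fps_X - fps_const C * fps_X ^ 3
          - fps_X * fps_sqrt1 (gegenbauer_quartic C)) n" for n
  proof -
    have coeff: "fps_nth (fps_const (C ^ 2) * fps_X - fps_const C * fps_X ^ 3
          - fps_X * fps_sqrt1 (gegenbauer_quartic C)) n =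
        (if n = 1 then C ^ 2 else 0) - (if n = 3 then C else 0)
          - (if n = 0 then 0 else to_fract (fps_nth S (n - 1)))"
      unfolding sqrt_C by (simp add: fps_X_power_iff)
    \<comment> \<open>Degrees below 4 lie outside \<open>proportional\<close>. The explicit terms
      settle them: at n = 1 they leave C^2 - 1, matching P(-3) = 1, and at n = 3 the term -C cancels
      the contribution of \<open>S2\<close>.\<close>
    consider "n = 0" | "n = 1" | "n = 2" | "n = 3" | l where "n = l + 4"
      using nat_cases3 [of "n - 1"] by (cases n) (auto simp: eval_nat_numeral)
    then show ?thesis
    proof cases
      case 1
      with coeff init show ?thesis by simp
    next
      case 2
      with coeff init S0 show ?thesis by (simp add: C_def)
    next
      case 3
      with coeff init S1 show ?thesis by (simp add: C_def)
    next
      case 4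
      with coeff init S2 show ?thesis by (simp add: C_def)
    next
      case 5
      have "fps_nth S (l + 3) = (1 - c ^ 2) * P (int l)"
        by (rule proportional)
      then show ?thesis
        unfolding coeff C2 using 5 by (simp add: add.commute left_diff_distrib)
    qed
  qed
  show ?thesis
  proof (fold c_def, fold C_def, intro conjI allI impI)
    have "fps_X ^ 4 - fps_const (2 * C) * fps_X ^ 2 + 1 =
        (gegenbauer_quartic C :: 'a poly fract fps)"
      by simp
    then show "Abs_fps (\<lambda>n. to_fract (P (int n - 4))) =
       fps_const (1 / (C ^ 2 - 1)) *
         (fps_const (C ^ 2) * fps_X - fps_const C * fps_X ^ 3
          - fps_X * fps_sqrt1 (fps_X ^ 4 - fps_const (2 * C) * fps_X ^ 2 + 1))"
      using nz by (intro fps_ext) (simp only: fps_mult_left_const_nth fps_nth_Abs_fps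
        gf [symmetric], simp)
  next
    show "P (2 * int m) = 0" for m
      by (rule even)
  next
    fix n :: nat
    assume "n \<ge> 2"
    then show "to_fract (P (2 * int n - 3)) =
        - to_fract (gegenbauer_minus_half n) / (C ^ 2 - 1)"
      using nz by (simp add: q C_def field_simps power2_eq_square)
  next
    fix n :: nat
    assume n: "n \<ge> 2"
    define p where "p = P (2 * int n - 3)"
    \<comment> \<open>By \<open>q\<close>, the Gegenbauer polynomial is
      \<open>(1 - c ^ 2) * p\<close>; its differential equation then contains a common factor
      \<open>1 - c ^ 2\<close>, which is cancelled.\<close>
    have "pderiv (pderiv ((1 - c ^ 2) * p)) =
        (1 - c ^ 2) * pderiv (pderiv p) - 4 * c * pderiv p - 2 * p"
      by (simp add: pderiv_mult pderiv_diff pderiv_add deriv_c power2_eq_square algebra_simps)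
    then have "(1 - c ^ 2) * ((1 - c ^ 2) * pderiv (pderiv p) - 4 * c * pderiv p
        - 2 * p + of_nat n * (of_nat n - 1) * p) = 0"
      using quartic_sqrt_nth_ode [OF square deriv_c, of n]
      unfolding geg [symmetric] q [OF n] p_def [symmetric] by algebra
    then have "(1 - c ^ 2) * pderiv (pderiv p) - 4 * c * pderiv p
        - 2 * p + of_nat n * (of_nat n - 1) * p = 0"
      using c2 by simp
    \<comment> \<open>The -2 from the second derivative of \<open>1 - c ^ 2\<close> turns n(n - 1)
      into (n + 1)(n - 2).\<close>
    moreover have "of_int ((int n + 1) * (int n - 2)) * p =
        of_nat n * (of_nat n - 1) * p - 2 * p"
      by (simp add: algebra_simps)
    ultimately show "(c ^ 2 - 1) * pderiv (pderiv (P (2 * int n - 3)))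
        + 4 * c * pderiv (P (2 * int n - 3))
        - of_int ((int n + 1) * (int n - 2)) * P (2 * int n - 3) = 0"
      unfolding p_def by (simp only:) (simp add: algebra_simps)
  qed
qed

end
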